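(* Let $h>0$, let $w:[0,\infty)\to\mathbb{R}$ be a continuous function (deterministic or random), let $T>0$, and let $\eta_T$ be the taut string associated with $w$ on $[0,T]$. Let $N(T)=\sup\{n : \bar t_n\le T\}$. If $N(T)\ge 4$, then for every integer $i$ with $2\le i\le N(T)-2$ the taut string $\eta_T$ and the function $\psi_i$ coincide on $[\bar t_i,\bar t_{i+1}]$.
   Context: $AC([a,b])$ is the set of absolutely continuous real functions on $[a,b]$, and $\|f\|_{\infty,[a,b]}=\sup_{[a,b]}|f|$. Taut string: $\eta_T$ is the function which, for every strictly convex function $c:\mathbb{R}\to\mathbb{R}$, is the unique minimizer of $\int_0^T c(\varphi'(u))\,du$ over all $\varphi\in AC([0,T])$ with $\varphi(0)=w(0)$, $\varphi(T)=w(T)$ and $\|w-\varphi\|_{\infty,[0,T]}\le h/2$ (the minimizer does not depend on the choice of $c$; e.g. one may take $c(x)=x^2$). Times: $t_0=\bar t_0=0$ and, for $n\ge 0$, $$t_{2n+1}=\inf\{t\ge t_{2n}: w(t)-\inf_{[t_{2n},t]}w=h\},\qquad t_{2n+2}=\inf\{t\ge t_{2n+1}:\sup_{[t_{2n+1},t]}w-w(t)=h\},$$ $$\bar t_{2n+1}=\sup\{t\in[t_{2n},t_{2n+1}]:\inf_{[t_{2n},t]}w=w(t)\},\qquad \bar t_{2n+2}=\sup\{t\in[t_{2n+1},t_{2n+2}]:\sup_{[t_{2n+1},t]}w=w(t)\}.$$ Conventions: $\inf\emptyset=+\infty$; an interval $[s,+\infty]$ is read as $[s,\infty)$; once some $t_n=+\infty$,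 all $t_m,\bar t_m$ with $m>n$ are $+\infty$. Functions $\psi_i$: for $i\ge1$ with $\bar t_{i+1}<\infty$, $\psi_i$ is the unique minimizer of $\int_{\bar t_i}^{\bar t_{i+1}}|\varphi'(u)|^2du$ over all $\varphi\in AC(I_i)$, $I_i=[\bar t_i,\bar t_{i+1}]$, with $\varphi(\bar t_i)=w(\bar t_i)-(-1)^i\frac h2$, $\varphi(\bar t_{i+1})=w(\bar t_{i+1})+(-1)^i\frac h2$ and $\|w-\varphi\|_{\infty,I_i}\le\frac h2$. *)

theory Defs
  imports "HOL-Analysis.Analysis"
begin

text \<open>
  Functions on an interval are total functions on the reals of which only the values on that
  interval matter.
\<close>

definition abs_cont_on :: "real \<Rightarrow> real \<Rightarrow> (real \<Rightarrow> real) \<Rightarrow> bool" where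
  "abs_cont_on a b f \<longleftrightarrow>
     (\<forall>\<epsilon>>0. \<exists>\<delta>>0. \<forall>D S. D division_of S \<longrightarrow> S \<subseteq> {a..b} \<longrightarrow> (\<Sum>K\<in>D. Sup K - Inf K) < \<delta> \<longrightarrow>
        (\<Sum>K\<in>D. \<bar>f (Sup K) - f (Inf K)\<bar>) < \<epsilon>)"

definition strictly_convex :: "(real \<Rightarrow> real) \<Rightarrow> bool" where
  "strictly_convex c \<longleftrightarrow>
     (\<forall>x y u. x \<noteq> y \<longrightarrow> 0 < u \<longrightarrow> u < 1 \<longrightarrow>
        c ((1 - u) * x + u * y) < (1 - u) * c x + u * c y)"

definition sup_norm_on :: "real \<Rightarrow> real \<Rightarrow> (real \<Rightarrow> real) \<Rightarrow> real" where
  "sup_norm_on a b f = (SUP t\<in>{a..b}. \<bar>f t\<bar>)"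

text \<open>
  The integral of \<open>c \<circ> \<phi>'\<close> over \<open>[a,b]\<close>, with values in the extended reals: the integral of the
  positive part minus that of the negative part. For convex \<open>c\<close> and absolutely continuous \<open>\<phi>\<close>
  the second is finite, as \<open>c\<close> has an affine minorant and \<open>\<phi>'\<close> is integrable; the first may
  be infinite. The null set where \<open>\<phi>\<close> is not differentiable does not contribute.
\<close>

definition cost :: "(real \<Rightarrow> real) \<Rightarrow> real \<Rightarrow> real \<Rightarrow> (real \<Rightarrow> real) \<Rightarrow> ereal" where
  "cost c a b \<phi> =
     enn2ereal (\<integral>\<^sup>+u\<in>{a..b}. ennreal (max 0 (c (deriv \<phi> u))) \<partial>lborel)
     - enn2ereal (\<integral>\<^sup>+u\<in>{a..b}. ennreal (max 0 (- c (deriv \<phi> u))) \<partial>lborel)"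

definition admissible ::
  "(real \<Rightarrow> real) \<Rightarrow> real \<Rightarrow> real \<Rightarrow> real \<Rightarrow> real \<Rightarrow> real \<Rightarrow> (real \<Rightarrow> real) set" where
  "admissible w h a b A B =
     {\<phi>. abs_cont_on a b \<phi> \<and> \<phi> a = A \<and> \<phi> b = B \<and> sup_norm_on a b (\<lambda>t. w t - \<phi> t) \<le> h / 2}"

definition unique_minimizer ::
  "(real \<Rightarrow> real) \<Rightarrow> real \<Rightarrow> real \<Rightarrow> (real \<Rightarrow> real) set \<Rightarrow> (real \<Rightarrow> real) \<Rightarrow> bool" where
  "unique_minimizer c a b S \<phi> \<longleftrightarrow>
     \<phi> \<in> S \<and> (\<forall>f\<in>S. cost c a b \<phi> \<le> cost c a b f) \<and>
     (\<forall>f\<in>S. (\<forall>g\<in>S. cost c a b f \<le> cost c a b g) \<longrightarrow> (\<forall>t\<in>{a..b}. f t = \<phi> t))"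

definition taut_string :: "(real \<Rightarrow> real) \<Rightarrow> real \<Rightarrow> real \<Rightarrow> (real \<Rightarrow> real) \<Rightarrow> bool" where
  "taut_string w h T \<eta> \<longleftrightarrow>
     (\<forall>c. strictly_convex c \<longrightarrow> unique_minimizer c 0 T (admissible w h 0 T (w 0) (w T)) \<eta>)"

text \<open>The infimum of the empty set is \<open>\<infinity>\<close> in the extended reals.\<close>

definition first_rise :: "(real \<Rightarrow> real) \<Rightarrow> real \<Rightarrow> real \<Rightarrow> ereal" where
  "first_rise w h s = Inf (ereal ` {t. s \<le> t \<and> w t - (INF u\<in>{s..t}. w u) = h})"

definition first_drop :: "(real \<Rightarrow> real) \<Rightarrow> real \<Rightarrow> real \<Rightarrow> ereal" where
  "first_drop w h s = Inf (ereal ` {t. s \<le> t \<and> (SUP u\<in>{s..t}. w u) - w t = h})"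

definition last_min :: "(real \<Rightarrow> real) \<Rightarrow> real \<Rightarrow> ereal \<Rightarrow> ereal" where
  "last_min w s e = Sup (ereal ` {t. s \<le> t \<and> ereal t \<le> e \<and> (INF u\<in>{s..t}. w u) = w t})"

definition last_max :: "(real \<Rightarrow> real) \<Rightarrow> real \<Rightarrow> ereal \<Rightarrow> ereal" where
  "last_max w s e = Sup (ereal ` {t. s \<le> t \<and> ereal t \<le> e \<and> (SUP u\<in>{s..t}. w u) = w t})"

primrec tm :: "(real \<Rightarrow> real) \<Rightarrow> real \<Rightarrow> nat \<Rightarrow> ereal" where
  "tm w h 0 = 0"
| "tm w h (Suc n) =
     (if tm w h n = \<infinity> then \<infinity>
      else if even n then first_rise w h (real_of_ereal (tm w h n))
      else first_drop w h (real_of_ereal (tm w h n)))"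

text \<open>
  If \<open>tm w h n\<close> is finite but \<open>tm w h (Suc n)\<close> is not, the supremum below runs over the
  half-line starting at \<open>tm w h n\<close>, and \<open>tbar w h (Suc n)\<close> may be finite or infinite.
\<close>

primrec tbar :: "(real \<Rightarrow> real) \<Rightarrow> real \<Rightarrow> nat \<Rightarrow> ereal" where
  "tbar w h 0 = 0"
| "tbar w h (Suc n) =
     (if tm w h n = \<infinity> then \<infinity>
      else if even n then last_min w (real_of_ereal (tm w h n)) (tm w h (Suc n))
      else last_max w (real_of_ereal (tm w h n)) (tm w h (Suc n)))"

definition tbar_count :: "(real \<Rightarrow> real) \<Rightarrow> real \<Rightarrow> real \<Rightarrow> enat" where
  "tbar_count w h T = Sup (enat ` {n. tbar w h n \<le> ereal T})"

definition is_psi :: "(real \<Rightarrow> real) \<Rightarrow> real \<Rightarrow> nat \<Rightarrow> (real \<Rightarrow> real) \<Rightarrow> bool" where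
  "is_psi w h i \<psi> \<longleftrightarrow>
     1 \<le> i \<and> tbar w h (i + 1) < \<infinity> \<and>
     (let a = real_of_ereal (tbar w h i); b = real_of_ereal (tbar w h (i + 1)) in
      unique_minimizer (\<lambda>x. \<bar>x\<bar>\<^sup>2) a b
        (admissible w h a b (w a - (-1) ^ i * (h / 2)) (w b + (-1) ^ i * (h / 2))) \<psi>)"

end

theory Submission
  imports Defs
begin

text \<open>
  Suppose \<open>w\<close> has its maximum over \<open>[tbar (i - 1), tbar (i + 1)]\<close> at \<open>s = tbar i\<close> (the other parity
  is the reflection \<open>w \<mapsto> - w\<close>). At both ends \<open>w\<close> is lower by at least \<open>h\<close>, so there the whole tube
  lies below the level \<open>L = w s - h/2\<close>, while the lower wall of the tube stays below \<open>L\<close> in between.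
  Truncating the taut string at \<open>L\<close> on this interval keeps it admissible and does not increase
  its energy; by uniqueness it was already below \<open>L\<close>, so it touches the lower wall at \<open>s\<close>.
  Hence the taut string satisfies the boundary conditions of \<open>\<psi> i\<close>, and pasting \<open>\<psi> i\<close> into it does not
  increase its energy either; uniqueness once more gives equality.
\<close>

subsection \<open>Absolutely continuous functions\<close>

lemma abs_cont_onI:
  assumes "\<And>\<epsilon>. \<epsilon> > 0 \<Longrightarrow> \<exists>\<delta>>0. \<forall>D S. D division_of S \<longrightarrow> S \<subseteq> {a..b} \<longrightarrow>
      (\<Sum>K\<in>D. Sup K - Inf K) < \<delta> \<longrightarrow> (\<Sum>K\<in>D. \<bar>f (Sup K) - f (Inf K)\<bar>) < \<epsilon>"
  shows "abs_cont_on a b f"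
  using assms unfolding abs_cont_on_def by blast

lemma abs_cont_on_subset:
  assumes "abs_cont_on a b f" "a \<le> c" "d \<le> b"
  shows "abs_cont_on c d f"
proof -
  have "{c..d} \<subseteq> {a..b}" using assms by auto
  then show ?thesis using assms(1) unfolding abs_cont_on_def by (meson order_trans)
qed

lemma division_real_intervalE:
  fixes D :: "real set set"
  assumes "D division_of S" "K \<in> D"
  obtains x y where "K = {x..y}" "x \<le> y" "Inf K = x" "Sup K = y"
proof -
  obtain x y where "K = cbox x y" "K \<noteq> {}"
    using assms by (metis division_ofD(3,4))
  then show ?thesis using that[of x y] by auto
qed

lemma division_of_end_mem:
  fixes D :: "real set set"
  assumes "D division_of S" "K \<in> D" "S \<subseteq> {a..b}"
  shows "Inf K \<in> {a..b}" "Sup K \<in> {a..b}"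
proof -
  obtain x y where xy: "K = {x..y}" "x \<le> y" "Inf K = x" "Sup K = y"
    using division_real_intervalE assms by metis
  have "K \<subseteq> S" using division_ofD(2)[OF assms(1,2)] .
  moreover have "Inf K \<in> K" "Sup K \<in> K" using xy by auto
  ultimately show "Inf K \<in> {a..b}" "Sup K \<in> {a..b}" using assms(3) by blast+
qed

text \<open>Comparing increments serves sums, differences and contractions at once; each of the two
  functions gets half of \<epsilon>.\<close>

lemma abs_cont_on_le_add:
  assumes "abs_cont_on a b f" "abs_cont_on a b g"
    and le: "\<And>x y. x \<in> {a..b} \<Longrightarrow> y \<in> {a..b} \<Longrightarrow> \<bar>k x - k y\<bar> \<le> \<bar>f x - f y\<bar> + \<bar>g x - g y\<bar>"
  shows "abs_cont_on a b k"
proof (rule abs_cont_onI)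
  fix \<epsilon> :: real assume "\<epsilon> > 0"
  then have e: "\<epsilon> / 2 > 0" by simp
  obtain d1 where d1: "d1 > 0" "\<And>D S. D division_of S \<Longrightarrow> S \<subseteq> {a..b} \<Longrightarrow> (\<Sum>K\<in>D. Sup K - Inf K) < d1 \<Longrightarrow>
        (\<Sum>K\<in>D. \<bar>f (Sup K) - f (Inf K)\<bar>) < \<epsilon> / 2"
    using assms(1) e unfolding abs_cont_on_def by meson
  obtain d2 where d2: "d2 > 0" "\<And>D S. D division_of S \<Longrightarrow> S \<subseteq> {a..b} \<Longrightarrow> (\<Sum>K\<in>D. Sup K - Inf K) < d2 \<Longrightarrow>
        (\<Sum>K\<in>D. \<bar>g (Sup K) - g (Inf K)\<bar>) < \<epsilon> / 2"
    using assms(2) e unfolding abs_cont_on_def by meson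
  show "\<exists>\<delta>>0. \<forall>D S. D division_of S \<longrightarrow> S \<subseteq> {a..b} \<longrightarrow>
      (\<Sum>K\<in>D. Sup K - Inf K) < \<delta> \<longrightarrow> (\<Sum>K\<in>D. \<bar>k (Sup K) - k (Inf K)\<bar>) < \<epsilon>"
  proof (intro exI[of _ "min d1 d2"] conjI allI impI)
    show "min d1 d2 > 0" using d1 d2 by simp
    fix D S assume D: "D division_of S" "S \<subseteq> {a..b}" "(\<Sum>K\<in>D. Sup K - Inf K) < min d1 d2"
    have "(\<Sum>K\<in>D. \<bar>k (Sup K) - k (Inf K)\<bar>)
        \<le> (\<Sum>K\<in>D. \<bar>f (Sup K) - f (Inf K)\<bar> + \<bar>g (Sup K) - g (Inf K)\<bar>)"
      by (intro sum_mono le division_of_end_mem[OF D(1) _ D(2)])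
    also have "\<dots> < \<epsilon>"
      using d1(2)[OF D(1,2)] d2(2)[OF D(1,2)] D(3) by (simp add: sum.distrib)
    finally show "(\<Sum>K\<in>D. \<bar>k (Sup K) - k (Inf K)\<bar>) < \<epsilon>" .
  qed
qed

lemma abs_cont_on_contract:
  assumes "abs_cont_on a b f"
    and "\<And>x y. x \<in> {a..b} \<Longrightarrow> y \<in> {a..b} \<Longrightarrow> \<bar>k x - k y\<bar> \<le> \<bar>f x - f y\<bar>"
  shows "abs_cont_on a b k"
proof (rule abs_cont_on_le_add[OF assms(1,1)])
  show "\<bar>k x - k y\<bar> \<le> \<bar>f x - f y\<bar> + \<bar>f x - f y\<bar>" if "x \<in> {a..b}" "y \<in> {a..b}" for x y
    using assms(2)[OF that] by linarith
qed

lemma abs_cont_on_continuous: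
  assumes "abs_cont_on a b f"
  shows "continuous_on {a..b} f"
  unfolding continuous_on_iff
proof (intro ballI allI impI)
  fix x e :: real assume x: "x \<in> {a..b}" and "e > 0"
  then obtain d where d: "d > 0" "\<And>D S. D division_of S \<Longrightarrow> S \<subseteq> {a..b} \<Longrightarrow> (\<Sum>K\<in>D. Sup K - Inf K) < d \<Longrightarrow>
        (\<Sum>K\<in>D. \<bar>f (Sup K) - f (Inf K)\<bar>) < e"
    using assms(1) unfolding abs_cont_on_def by meson
  show "\<exists>d>0. \<forall>x'\<in>{a..b}. dist x' x < d \<longrightarrow> dist (f x') (f x) < e"
  proof (intro exI[of _ d] conjI ballI impI)
    show "d > 0" by fact
    have close: "\<bar>f v - f u\<bar> < e" if "u \<in> {a..b}" "v \<in> {a..b}" "u \<le> v" "v - u < d" for u v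
      using d(2)[of "{{u..v}}" "{u..v}"] division_of_self[of u v] that by auto
    fix y assume "y \<in> {a..b}" "dist y x < d"
    then show "dist (f y) (f x) < e"
      using close[of x y] close[of y x] x by (cases "x \<le> y") (auto simp: dist_real_def abs_minus_commute)
  qed
qed

text \<open>The clamp \<open>c\<close> is monotone and does not increase lengths, so it carries a
  division inside \<open>{a..b}\<close> to intervals inside \<open>{p..q}\<close> of no greater
  total length.\<close>

lemma abs_cont_on_clamp:
  assumes f: "abs_cont_on p q f" and "p \<le> q"
  shows "abs_cont_on a b (\<lambda>t. f (max p (min q t)))"
proof (rule abs_cont_onI)
  fix \<epsilon> :: real assume "\<epsilon> > 0"
  then obtain d where d: "d > 0" "\<And>D S. D division_of S \<Longrightarrow> S \<subseteq> {p..q} \<Longrightarrow> (\<Sum>K\<in>D. Sup K - Inf K) < d \<Longrightarrow>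
        (\<Sum>K\<in>D. \<bar>f (Sup K) - f (Inf K)\<bar>) < \<epsilon>"
    using f unfolding abs_cont_on_def by meson
  define c where "c t = max p (min q t)" for t
  have c_mono: "c x \<le> c y" "c y - c x \<le> y - x" if "x \<le> y" for x y
    using that by (auto simp: c_def max_def min_def)
  have c_range: "p \<le> c x" "c x \<le> q" "x \<le> p \<or> c x \<le> x" "q \<le> x \<or> x \<le> c x" for x
    using \<open>p \<le> q\<close> by (auto simp: c_def)
  have c_eq: "c x = p" if "x \<le> p" for x using that \<open>p \<le> q\<close> by (auto simp: c_def)
  have c_eq': "c x = q" if "q \<le> x" for x using that \<open>p \<le> q\<close> by (auto simp: c_def)
  have "\<exists>\<delta>>0. \<forall>D S. D division_of S \<longrightarrow> S \<subseteq> {a..b} \<longrightarrow>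
      (\<Sum>K\<in>D. Sup K - Inf K) < \<delta> \<longrightarrow> (\<Sum>K\<in>D. \<bar>f (c (Sup K)) - f (c (Inf K))\<bar>) < \<epsilon>"
  proof (intro exI[of _ d] conjI allI impI)
    show "d > 0" by fact
    fix D S assume D: "D division_of S" "S \<subseteq> {a..b}" "(\<Sum>K\<in>D. Sup K - Inf K) < d"
    \<comment> \<open>Intervals that \<open>c\<close> collapses to a point contribute nothing, and
      many of them may share one image. The others have images with disjoint nonempty interiors,
      hence distinct.\<close>
    define E where "E = {K\<in>D. c (Inf K) < c (Sup K)}"
    define r where "r K = {c (Inf K)..c (Sup K)}" for K
    have finD: "finite D" using D(1) by blast
    have finE: "finite E" using finD by (simp add: E_def)
    have le: "Inf K \<le> Sup K" if "K \<in> D" for K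
      using division_real_intervalE[OF D(1) that] by metis
    have sub: "interior (r K) \<subseteq> interior K" if K: "K \<in> E" for K
    proof -
      have KD: "K \<in> D" and lt: "c (Inf K) < c (Sup K)" using K by (auto simp: E_def)
      obtain x y where xy: "K = {x..y}" "x \<le> y" "Inf K = x" "Sup K = y"
        using division_real_intervalE[OF D(1) KD] by metis
      have "x \<le> c x" "c y \<le> y"
        using lt xy c_range c_eq c_eq' by (metis antisym linorder_not_le order.strict_trans1)+
      then have "r K \<subseteq> K" using xy by (auto simp: r_def)
      then show ?thesis by (rule interior_mono)
    qed
    have ne: "interior (r K) \<noteq> {}" if "K \<in> E" for K
      using that by (simp add: r_def E_def)
    have disj: "interior (r K) \<inter> interior (r L) = {}" if "K \<in> E" "L \<in> E" "K \<noteq> L" for K L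
    proof -
      have "interior K \<inter> interior L = {}"
        using division_ofD(5)[OF D(1)] that by (auto simp: E_def)
      then show ?thesis using sub that by blast
    qed
    have inj: "inj_on r E"
      by (rule inj_onI) (metis disj ne inf.idem)
    have div: "(r ` E) division_of (\<Union>(r ` E))"
      unfolding division_of_def
    proof (intro conjI ballI impI)
      show "finite (r ` E)" using finE by simp
      show "K \<subseteq> \<Union>(r ` E)" "K \<noteq> {}" "\<exists>a b. K = cbox a b" if K: "K \<in> r ` E" for K
        using K by (auto simp: r_def E_def)
      show "interior K \<inter> interior L = {}" if "K \<in> r ` E" "L \<in> r ` E" "K \<noteq> L" for K L
        using disj that by blast
    qed auto
    have subp: "\<Union>(r ` E) \<subseteq> {p..q}" using c_range order_trans by (fastforce simp: r_def)
    have ends: "Sup (r K) = c (Sup K)" "Inf (r K) = c (Inf K)" if "K \<in> E" for K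
      using that by (auto simp: r_def E_def)
    have "(\<Sum>K\<in>r ` E. Sup K - Inf K) = (\<Sum>K\<in>E. c (Sup K) - c (Inf K))"
      unfolding sum.reindex[OF inj] using ends by simp
    also have "\<dots> \<le> (\<Sum>K\<in>E. Sup K - Inf K)"
      by (intro sum_mono c_mono le) (simp add: E_def)
    also have "\<dots> \<le> (\<Sum>K\<in>D. Sup K - Inf K)"
      by (intro sum_mono2[OF finD]) (use le in \<open>auto simp: E_def\<close>)
    finally have "(\<Sum>K\<in>r ` E. Sup K - Inf K) < d" using D(3) by simp
    from d(2)[OF div subp this]
    have "(\<Sum>K\<in>E. \<bar>f (c (Sup K)) - f (c (Inf K))\<bar>) < \<epsilon>"
      unfolding sum.reindex[OF inj] using ends by simp
    also have "(\<Sum>K\<in>E. \<bar>f (c (Sup K)) - f (c (Inf K))\<bar>) = (\<Sum>K\<in>D. \<bar>f (c (Sup K)) - f (c (Inf K))\<bar>)"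
    proof (rule sum.mono_neutral_left[OF finD])
      show "\<forall>K\<in>D - E. \<bar>f (c (Sup K)) - f (c (Inf K))\<bar> = 0"
      proof
        fix K assume "K \<in> D - E"
        moreover from this have "c (Inf K) \<le> c (Sup K)"
          by (intro c_mono le) simp
        ultimately have "c (Inf K) = c (Sup K)" by (auto simp: E_def)
        then show "\<bar>f (c (Sup K)) - f (c (Inf K))\<bar> = 0" by simp
      qed
    qed (auto simp: E_def)
    finally show "(\<Sum>K\<in>D. \<bar>f (c (Sup K)) - f (c (Inf K))\<bar>) < \<epsilon>" .
  qed
  then show "\<exists>\<delta>>0. \<forall>D S. D division_of S \<longrightarrow> S \<subseteq> {a..b} \<longrightarrow>
      (\<Sum>K\<in>D. Sup K - Inf K) < \<delta> \<longrightarrow>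
      (\<Sum>K\<in>D. \<bar>f (max p (min q (Sup K))) - f (max p (min q (Inf K)))\<bar>) < \<epsilon>"
    unfolding c_def .
qed

text \<open>The splice is \<open>f\<close> plus the clamped difference of \<open>g\<close> and
  \<open>f\<close>; this difference vanishes at \<open>p\<close> and \<open>q\<close>, so its
  constant extension is zero outside.\<close>

lemma abs_cont_on_splice:
  assumes f: "abs_cont_on a b f" and g: "abs_cont_on p q g"
    and "a \<le> p" "p \<le> q" "q \<le> b" "g p = f p" "g q = f q"
  shows "abs_cont_on a b (\<lambda>t. if t \<in> {p..q} then g t else f t)"
proof -
  have "abs_cont_on p q f" using abs_cont_on_subset f assms by blast
  then have "abs_cont_on p q (\<lambda>t. g t - f t)"
    by (rule abs_cont_on_le_add[OF g]) linarith
  from abs_cont_on_clamp[OF this \<open>p \<le> q\<close>, of a b]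
  show ?thesis
  proof (rule abs_cont_on_le_add[OF f])
    let ?s = "\<lambda>t. if t \<in> {p..q} then g t else f t"
    let ?d = "\<lambda>t. g (max p (min q t)) - f (max p (min q t))"
    have "?s t = f t + ?d t" for t
      using assms by (auto simp: max_def min_def)
    then have "?s x - ?s y = (f x - f y) + (?d x - ?d y)" for x y
      by (simp only: add_diff_add)
    then show "\<bar>?s x - ?s y\<bar> \<le> \<bar>f x - f y\<bar> + \<bar>?d x - ?d y\<bar>" for x y
      by (simp only: abs_triangle_ineq)
  qed
qed

subsection \<open>Minimizers of the energy in a tube\<close>

text \<open>No measurability of \<open>f\<close> is assumed: this avoids showing that \<open>deriv\<close> of a continuous
  function is Borel.\<close>

lemma nn_integral_split_set:
  assumes A[measurable]: "A \<in> sets M"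
  shows "(\<integral>\<^sup>+x. f x \<partial>M) = (\<integral>\<^sup>+x. f x * indicator A x \<partial>M) + (\<integral>\<^sup>+x. f x * indicator (- A) x \<partial>M)"
proof (rule antisym)
  have "integral\<^sup>S M s \<le> (\<integral>\<^sup>+x. f x * indicator A x \<partial>M) + (\<integral>\<^sup>+x. f x * indicator (- A) x \<partial>M)"
    if s: "simple_function M s" "s \<le> f" for s
  proof -
    \<comment> \<open>A simple minorant is measurable whatever \<open>f\<close> is, so additivity
      applies to its two pieces.\<close>
    have [measurable]: "s \<in> borel_measurable M"
      using s(1) by (rule borel_measurable_simple_function)
    have "integral\<^sup>S M s = (\<integral>\<^sup>+x. s x * indicator A x + s x * indicator (space M - A) x \<partial>M)"
      unfolding nn_integral_eq_simple_integral[OF s(1), symmetric]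
      by (intro nn_integral_cong) (auto simp: indicator_def)
    also have "\<dots> = (\<integral>\<^sup>+x. s x * indicator A x \<partial>M) + (\<integral>\<^sup>+x. s x * indicator (space M - A) x \<partial>M)"
      by (rule nn_integral_add) measurable
    also have "\<dots> \<le> (\<integral>\<^sup>+x. f x * indicator A x \<partial>M) + (\<integral>\<^sup>+x. f x * indicator (- A) x \<partial>M)"
      using s(2) by (intro add_mono nn_integral_mono) (auto simp: indicator_def le_fun_def)
    finally show ?thesis .
  qed
  then show "(\<integral>\<^sup>+x. f x \<partial>M) \<le> (\<integral>\<^sup>+x. f x * indicator A x \<partial>M) + (\<integral>\<^sup>+x. f x * indicator (- A) x \<partial>M)"
    unfolding nn_integral_def[of M f] by (intro SUP_least) auto
next
  let ?S = "\<lambda>f. {g. simple_function M g \<and> g \<le> f}"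
  let ?I = "\<lambda>f. integral\<^sup>N M f"
  have ne: "?S g \<noteq> {}" for g :: "'a \<Rightarrow> ennreal"
    by (auto intro!: exI[of _ "\<lambda>x. 0"] simp: le_fun_def)
  \<comment> \<open>Simple minorants of the two parts vanish on complementary sets, so their sum is
    a minorant of \<open>f\<close>.\<close>
  have sum: "integral\<^sup>S M s + integral\<^sup>S M t \<le> ?I f"
    if s: "s \<in> ?S (\<lambda>x. f x * indicator A x)" and t: "t \<in> ?S (\<lambda>x. f x * indicator (- A) x)" for s t
  proof -
    have sm: "simple_function M s" "simple_function M t" using s t by auto
    have [measurable]: "s \<in> borel_measurable M" "t \<in> borel_measurable M"
      using sm by (auto intro: borel_measurable_simple_function)
    have "integral\<^sup>S M s + integral\<^sup>S M t = (\<integral>\<^sup>+x. s x + t x \<partial>M)"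
      using sm by (subst nn_integral_add) (auto simp: nn_integral_eq_simple_integral)
    also have "\<dots> \<le> ?I f"
    proof (rule nn_integral_mono)
      fix x
      have "s x \<le> f x * indicator A x" "t x \<le> f x * indicator (- A) x"
        using s t by (auto simp: le_fun_def)
      then show "s x + t x \<le> f x" by (cases "x \<in> A") auto
    qed
    finally show ?thesis .
  qed
  have step: "integral\<^sup>S M s + ?I (\<lambda>x. f x * indicator (- A) x) \<le> ?I f"
    if s: "s \<in> ?S (\<lambda>x. f x * indicator A x)" for s
    unfolding nn_integral_def[of M "\<lambda>x. f x * indicator (- A) x"]
    by (subst ennreal_SUP_add_right[OF ne]) (use sum[OF s] in \<open>auto intro!: SUP_least\<close>)
  show "?I (\<lambda>x. f x * indicator A x) + ?I (\<lambda>x. f x * indicator (- A) x) \<le> ?I f"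
    unfolding nn_integral_def[of M "\<lambda>x. f x * indicator A x"]
    by (subst ennreal_SUP_add_left[OF ne, symmetric]) (use step in \<open>auto intro!: SUP_least\<close>)
qed

text \<open>Each point of \<open>S\<close> owns a basic open set that meets \<open>S\<close> only
  there, which injects \<open>S\<close> into a countable basis.\<close>

lemma countable_isolated:
  fixes S :: "'a::second_countable_topology set"
  assumes "\<And>x. x \<in> S \<Longrightarrow> \<exists>U. open U \<and> x \<in> U \<and> U \<inter> S \<subseteq> {x}"
  shows "countable S"
proof -
  obtain B :: "'a set set" where B: "countable B" "topological_basis B"
    using ex_countable_basis by blast
  have "\<exists>V\<in>B. V \<inter> S = {x}" if x: "x \<in> S" for x
  proof -
    obtain U where U: "open U" "x \<in> U" "U \<inter> S \<subseteq> {x}" using assms[OF x] by (elim exE conjE)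
    obtain V where "V \<in> B" "x \<in> V" "V \<subseteq> U"
      by (rule topological_basisE[OF B(2) U(1,2)])
    then show ?thesis using U x by (intro bexI[of _ V]) auto
  qed
  then obtain V where V: "\<And>x. x \<in> S \<Longrightarrow> V x \<in> B \<and> V x \<inter> S = {x}"
    by (subst (asm) Bex_def) metis
  then have "inj_on V S" by (metis inj_onI singleton_inject)
  moreover have "V ` S \<subseteq> B" using V by blast
  ultimately show ?thesis using B(1) by (meson countable_image_inj_on countable_subset)
qed

section \<open>The tube condition and the quadratic energy\<close>

lemma sup_norm_on_le_iff:
  assumes "continuous_on {a..b} f" "a \<le> b"
  shows "sup_norm_on a b f \<le> c \<longleftrightarrow> (\<forall>t\<in>{a..b}. \<bar>f t\<bar> \<le> c)"
proof -
  have "compact ((\<lambda>t. \<bar>f t\<bar>) ` {a..b})"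
    using assms(1) by (intro compact_continuous_image continuous_intros) auto
  then have "bdd_above ((\<lambda>t. \<bar>f t\<bar>) ` {a..b})"
    by (intro bounded_imp_bdd_above compact_imp_bounded)
  then show ?thesis
    unfolding sup_norm_on_def using assms(2) by (intro cSUP_le_iff) auto
qed

lemma mem_admissible_iff:
  assumes "continuous_on {a..b} w" "a \<le> b"
  shows "\<phi> \<in> admissible w h a b A B \<longleftrightarrow>
    abs_cont_on a b \<phi> \<and> \<phi> a = A \<and> \<phi> b = B \<and> (\<forall>t\<in>{a..b}. \<bar>w t - \<phi> t\<bar> \<le> h / 2)"
proof -
  have "sup_norm_on a b (\<lambda>t. w t - \<phi> t) \<le> h / 2 \<longleftrightarrow> (\<forall>t\<in>{a..b}. \<bar>w t - \<phi> t\<bar> \<le> h / 2)"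
    if "abs_cont_on a b \<phi>"
    using assms abs_cont_on_continuous[OF that]
    by (intro sup_norm_on_le_iff continuous_intros) auto
  then show ?thesis by (auto simp: admissible_def)
qed

text \<open>The cost of the square, kept in \<open>ennreal\<close>: its negative part vanishes, so
  no difference of extended reals has to be handled.\<close>

definition energy :: "real \<Rightarrow> real \<Rightarrow> (real \<Rightarrow> real) \<Rightarrow> ennreal" where
  "energy a b f = (\<integral>\<^sup>+u\<in>{a..b}. ennreal ((deriv f u)\<^sup>2) \<partial>lborel)"

lemma cost_square: "cost (\<lambda>x. \<bar>x\<bar>\<^sup>2) a b f = enn2ereal (energy a b f)"
  by (simp add: cost_def energy_def zero_ennreal.rep_eq)

lemma strictly_convex_square: "strictly_convex (\<lambda>x. \<bar>x\<bar>\<^sup>2)"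
  unfolding strictly_convex_def
proof (intro allI impI)
  fix x y u :: real assume "x \<noteq> y" "0 < u" "u < 1"
  then have "0 < u * (1 - u) * (x - y)\<^sup>2" by simp
  also have "\<dots> = (1 - u) * x\<^sup>2 + u * y\<^sup>2 - ((1 - u) * x + u * y)\<^sup>2"
    by (simp add: power2_eq_square algebra_simps)
  finally show "\<bar>(1 - u) * x + u * y\<bar>\<^sup>2 < (1 - u) * \<bar>x\<bar>\<^sup>2 + u * \<bar>y\<bar>\<^sup>2" by simp
qed

lemma energy_mono:
  assumes "countable N"
    and "\<And>u. u \<in> {a<..<b} \<Longrightarrow> u \<notin> N \<Longrightarrow> (deriv f u)\<^sup>2 \<le> (deriv g u)\<^sup>2"
  shows "energy a b f \<le> energy a b g"
  unfolding energy_def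
proof (rule nn_integral_mono_AE)
  \<comment> \<open>\<open>deriv\<close> at \<open>a\<close> and \<open>b\<close> depends on values
    outside the interval, so the endpoints join the null set.\<close>
  have "N \<union> {a, b} \<in> null_sets lborel"
    using assms(1) by (intro countable_imp_null_set_lborel) auto
  then have "AE u in lborel. u \<notin> N \<union> {a, b}" by (rule AE_not_in)
  then show "AE u in lborel. ennreal ((deriv f u)\<^sup>2) * indicator {a..b} u
      \<le> ennreal ((deriv g u)\<^sup>2) * indicator {a..b} u"
    by eventually_elim (auto simp: indicator_def intro!: ennreal_leI assms(2))
qed

text \<open>\<open>deriv\<close> is local: off the null set \<open>{p, q}\<close> the splice has the
  derivative of \<open>g\<close> inside and that of \<open>f\<close> outside, so only the energy
  over \<open>{p..q}\<close> changes.\<close>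

lemma energy_splice:
  fixes f g :: "real \<Rightarrow> real" and p q :: real
  defines "k \<equiv> \<lambda>t. if t \<in> {p..q} then g t else f t"
  assumes "a \<le> p" "q \<le> b" "energy p q g \<le> energy p q f"
  shows "energy a b k \<le> energy a b f"
proof -
  have ins: "deriv k u = deriv g u" if "u \<in> {p<..<q}" for u
  proof (rule deriv_cong_ev[OF _ refl])
    show "\<forall>\<^sub>F x in nhds u. k x = g x"
      using eventually_nhds_in_open[OF open_greaterThanLessThan that]
      by eventually_elim (auto simp: k_def)
  qed
  have outs: "deriv k u = deriv f u" if "u \<in> - {p..q}" for u
  proof (rule deriv_cong_ev[OF _ refl])
    show "\<forall>\<^sub>F x in nhds u. k x = f x"
      using eventually_nhds_in_open[OF open_Compl[OF closed_atLeastAtMost] that]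
      by eventually_elim (auto simp: k_def)
  qed
  have part: "(\<integral>\<^sup>+u. ennreal ((deriv x u)\<^sup>2) * indicator {a..b} u * indicator {p..q} u \<partial>lborel)
      = energy p q x" for x
    unfolding energy_def using assms(2,3)
    by (intro nn_integral_cong) (auto simp: indicator_def)
  have "energy p q k \<le> energy p q g"
    by (rule energy_mono[of "{}"]) (auto simp: ins)
  then have "energy p q k \<le> energy p q f" using assms(4) by (rule order_trans)
  moreover have "energy a b x = energy p q x
      + (\<integral>\<^sup>+u. ennreal ((deriv x u)\<^sup>2) * indicator {a..b} u * indicator (- {p..q}) u \<partial>lborel)" for x
    unfolding part[symmetric] unfolding energy_def[of a b]
    by (rule nn_integral_split_set) simp
  ultimately show ?thesis
    by (simp only:) (intro add_mono nn_integral_mono; simp add: indicator_def outs)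
qed

text \<open>The splice of \<open>g\<close> into \<eta> is admissible and costs no more, so it too is
  a minimizer and uniqueness applies. This serves both for truncating \<eta> and for pasting in
  \<psi>.\<close>

lemma unique_minimizer_replace:
  assumes min: "unique_minimizer (\<lambda>x. \<bar>x\<bar>\<^sup>2) a b (admissible w h a b A B) \<eta>"
    and w: "continuous_on {a..b} w" and pq: "a \<le> p" "p \<le> q" "q \<le> b"
    and g: "abs_cont_on p q g" "g p = \<eta> p" "g q = \<eta> q" "\<And>t. t \<in> {p..q} \<Longrightarrow> \<bar>w t - g t\<bar> \<le> h / 2"
    and le: "energy p q g \<le> energy p q \<eta>"
    and t: "t \<in> {p..q}"
  shows "g t = \<eta> t"
proof -
  let ?S = "admissible w h a b A B"
  let ?k = "\<lambda>t. if t \<in> {p..q} then g t else \<eta> t"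
  have "a \<le> b" using pq by linarith
  note adm = mem_admissible_iff[OF w this]
  have \<eta>: "\<eta> \<in> ?S" and opt: "\<And>f. f \<in> ?S \<Longrightarrow> cost (\<lambda>x. \<bar>x\<bar>\<^sup>2) a b \<eta> \<le> cost (\<lambda>x. \<bar>x\<bar>\<^sup>2) a b f"
    and uniq: "\<And>f t. f \<in> ?S \<Longrightarrow> (\<And>g. g \<in> ?S \<Longrightarrow> cost (\<lambda>x. \<bar>x\<bar>\<^sup>2) a b f \<le> cost (\<lambda>x. \<bar>x\<bar>\<^sup>2) a b g)
      \<Longrightarrow> t \<in> {a..b} \<Longrightarrow> f t = \<eta> t"
    using min unfolding unique_minimizer_def by blast+
  have "?k \<in> ?S"
    using \<eta> g pq abs_cont_on_splice[of a b \<eta> p q g] unfolding adm by auto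
  moreover have "cost (\<lambda>x. \<bar>x\<bar>\<^sup>2) a b ?k \<le> cost (\<lambda>x. \<bar>x\<bar>\<^sup>2) a b f" if "f \<in> ?S" for f
  proof -
    have "cost (\<lambda>x. \<bar>x\<bar>\<^sup>2) a b ?k \<le> cost (\<lambda>x. \<bar>x\<bar>\<^sup>2) a b \<eta>"
      unfolding cost_square using energy_splice[OF pq(1,3) le]
      by (simp add: less_eq_ennreal.rep_eq)
    then show ?thesis using opt[OF that] by (rule order_trans)
  qed
  ultimately have "?k t = \<eta> t" using uniq[of ?k t] t pq by simp
  then show ?thesis using t by simp
qed

section \<open>Truncation at a level\<close>

text \<open>Near such a point the difference quotient stays nonzero, so the level is not taken again
  and the point is isolated. These are the points where truncation at \<open>L\<close> makes a
  corner.\<close>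

lemma countable_level_set_deriv_nonzero:
  fixes f :: "real \<Rightarrow> real"
  shows "countable {x. f x = L \<and> (\<exists>D. D \<noteq> 0 \<and> DERIV f x :> D)}" (is "countable ?Z")
proof (rule countable_isolated)
  fix x assume "x \<in> ?Z"
  then obtain D where x: "f x = L" "D \<noteq> 0" "DERIV f x :> D" by blast
  then have "((\<lambda>y. (f y - f x) / (y - x)) \<longlongrightarrow> D) (at x)"
    by (simp add: has_field_derivative_iff)
  from tendsto_imp_eventually_ne[OF this x(2)]
  obtain U where "open U" "x \<in> U" "\<And>y. y \<in> U \<Longrightarrow> y \<noteq> x \<Longrightarrow> (f y - f x) / (y - x) \<noteq> 0"
    by (auto simp: eventually_at_topological)
  then show "\<exists>U. open U \<and> x \<in> U \<and> U \<inter> ?Z \<subseteq> {x}"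
    using x(1) by (intro exI[of _ U]) auto
qed

text \<open>\<open>deriv\<close> chooses a value satisfying a predicate; here both predicates are
  constantly false, hence equal, and so are the choices.\<close>

lemma deriv_not_differentiable_eq:
  assumes "\<nexists>D. (f has_field_derivative D) (at x)" "\<nexists>D. (g has_field_derivative D) (at y)"
  shows "deriv f x = deriv g y"
  using assms by (simp add: deriv_def)

text \<open>The square absorbs two cases: a genuine derivative changes sign, while the junk value of
  \<open>deriv\<close> stays the same.\<close>

lemma deriv_uminus_square: "(deriv (\<lambda>t. - f t) x)\<^sup>2 = (deriv f x :: real)\<^sup>2"
proof (cases "\<exists>D. DERIV f x :> D")
  case True
  then obtain D where "DERIV f x :> D" by blast
  then show ?thesis using DERIV_minus[OF \<open>DERIV f x :> D\<close>] by (simp add: DERIV_imp_deriv)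
next
  case False
  then have "\<nexists>D. DERIV (\<lambda>t. - f t) x :> D" using DERIV_minus[of "\<lambda>t. - f t"] by fastforce
  then show ?thesis using False deriv_not_differentiable_eq by metis
qed

text \<open>Where neither function is differentiable, \<open>deriv\<close> takes the same junk value for both; hence
  almost everywhere differentiability of absolutely continuous functions is not needed.\<close>

lemma energy_min_const_le:
  fixes f :: "real \<Rightarrow> real"
  assumes f: "continuous_on {p..q} f"
  shows "energy p q (\<lambda>t. min (f t) L) \<le> energy p q f"
proof (rule energy_mono[OF countable_level_set_deriv_nonzero[of f L]])
  let ?g = "\<lambda>t. min (f t) L"
  fix u assume u: "u \<in> {p<..<q}" and N: "u \<notin> {x. f x = L \<and> (\<exists>D. D \<noteq> 0 \<and> DERIV f x :> D)}"
  have "isCont f u"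
    using f u by (intro continuous_on_interior[of "{p..q}"]) (auto simp: interior_atLeastAtMost_real)
  then have cont: "(f \<longlongrightarrow> f u) (nhds u)" by (simp add: isCont_def tendsto_nhds_iff)
  consider "f u < L" | "f u > L" | "f u = L" by linarith
  then show "(deriv ?g u)\<^sup>2 \<le> (deriv f u)\<^sup>2"
  proof cases
    case 1
    have "\<forall>\<^sub>F x in nhds u. ?g x = f x"
      using order_tendstoD(2)[OF cont 1] by eventually_elim simp
    then show ?thesis by (simp add: deriv_cong_ev)
  next
    case 2
    have "\<forall>\<^sub>F x in nhds u. ?g x = L"
      using order_tendstoD(1)[OF cont 2] by eventually_elim simp
    then have "deriv ?g u = deriv (\<lambda>x. L) u" by (simp add: deriv_cong_ev)
    then show ?thesis by simp
  next
    case 3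
    show ?thesis
    proof (cases "\<exists>D. DERIV f u :> D")
      case True
      then obtain D where "DERIV f u :> D" by blast
      moreover from this have "D = 0" using N 3 by blast
      ultimately have "DERIV f u :> 0" by simp
      then have lim: "((\<lambda>y. (f y - f u) / (y - u)) \<longlongrightarrow> 0) (at u)"
        by (simp add: has_field_derivative_iff)
      \<comment> \<open>Since \<open>f u = L\<close>, the increments of \<open>?g\<close> from
        \<open>u\<close> are no larger in absolute value than those of \<open>f\<close>.\<close>
      have "((\<lambda>y. (?g y - ?g u) / (y - u)) \<longlongrightarrow> 0) (at u)"
        by (rule tendsto_0_le[OF lim, of _ 1])
          (auto simp: 3 min_def abs_divide intro!: always_eventually divide_right_mono)
      then have "DERIV ?g u :> 0" by (simp add: has_field_derivative_iff)
      then show ?thesis by (simp add: DERIV_imp_deriv)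
    next
      case False
      show ?thesis
      proof (cases "\<exists>D. DERIV ?g u :> D")
        case True
        then obtain D where D: "DERIV ?g u :> D" by blast
        \<comment> \<open>\<open>?g\<close> has a maximum at \<open>u\<close>, so its derivative is
          zero, and zero is below any square, whatever \<open>deriv f u\<close> is.\<close>
        then have "D = 0" by (rule DERIV_local_max[of _ _ _ 1]) (auto simp: 3)
        then show ?thesis using D by (simp add: DERIV_imp_deriv)
      next
        case False
        then show ?thesis
          using deriv_not_differentiable_eq[OF \<open>\<nexists>D. DERIV f u :> D\<close> False] by simp
      qed
    qed
  qed
qed

text \<open>The bounds at \<open>p\<close> and \<open>q\<close> preserve the end values under
  truncation at \<open>L\<close>, and the bound on the lower wall keeps the truncation in the tube;
  by uniqueness it changes nothing.\<close>

lemma unique_minimizer_le: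
  assumes min: "unique_minimizer (\<lambda>x. \<bar>x\<bar>\<^sup>2) a b (admissible w h a b A B) \<eta>"
    and w: "continuous_on {a..b} w" and pq: "a \<le> p" "q \<le> b" "s \<in> {p..q}"
    and L: "\<eta> p \<le> L" "\<eta> q \<le> L" "\<And>t. t \<in> {p..q} \<Longrightarrow> w t - h / 2 \<le> L"
  shows "\<eta> s \<le> L"
proof -
  let ?g = "\<lambda>t. min (\<eta> t) L"
  have pq': "p \<le> q" "a \<le> b" using pq by auto
  have \<eta>: "abs_cont_on a b \<eta>" "\<And>t. t \<in> {a..b} \<Longrightarrow> \<bar>w t - \<eta> t\<bar> \<le> h / 2"
    using min unfolding unique_minimizer_def mem_admissible_iff[OF w pq'(2)] by auto
  have ac: "abs_cont_on p q \<eta>" using abs_cont_on_subset[OF \<eta>(1) pq(1,2)] .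
  have "?g s = \<eta> s"
  proof (rule unique_minimizer_replace[OF min w pq(1) pq'(1) pq(2) _ _ _ _ _ pq(3)])
    show "abs_cont_on p q ?g" by (rule abs_cont_on_contract[OF ac]) auto
    show "energy p q ?g \<le> energy p q \<eta>"
      by (rule energy_min_const_le[OF abs_cont_on_continuous[OF ac]])
    show "\<bar>w t - ?g t\<bar> \<le> h / 2" if "t \<in> {p..q}" for t
    proof -
      have "\<bar>w t - \<eta> t\<bar> \<le> h / 2" "w t - h / 2 \<le> L"
        using \<eta>(2)[of t] L(3)[of t] that pq by auto
      then show ?thesis by linarith
    qed
  qed (use L in auto)
  then show ?thesis by linarith
qed

text \<open>At \<open>p\<close> and \<open>q\<close> the upper wall is at most
  \<open>w s - h / 2\<close>, a level that the lower wall never exceeds on \<open>{p..q}\<close>.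
  The lower wall at \<open>s\<close> gives the reverse inequality.\<close>

lemma unique_minimizer_at_peak:
  assumes min: "unique_minimizer (\<lambda>x. \<bar>x\<bar>\<^sup>2) a b (admissible w h a b A B) \<eta>"
    and w: "continuous_on {a..b} w" and pq: "a \<le> p" "q \<le> b" "s \<in> {p..q}"
    and peak: "\<And>t. t \<in> {p..q} \<Longrightarrow> w t \<le> w s" "w p + h \<le> w s" "w q + h \<le> w s"
  shows "\<eta> s = w s - h / 2"
proof -
  have ab: "a \<le> b" using pq by auto
  have \<eta>: "\<And>t. t \<in> {a..b} \<Longrightarrow> \<bar>w t - \<eta> t\<bar> \<le> h / 2"
    using min unfolding unique_minimizer_def mem_admissible_iff[OF w ab] by auto
  have pqs: "\<bar>w p - \<eta> p\<bar> \<le> h / 2" "\<bar>w q - \<eta> q\<bar> \<le> h / 2" "\<bar>w s - \<eta> s\<bar> \<le> h / 2"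
    using pq \<eta>[of p] \<eta>[of q] \<eta>[of s] by auto
  have "\<eta> s \<le> w s - h / 2"
  proof (rule unique_minimizer_le[OF min w pq])
    show "\<eta> p \<le> w s - h / 2" "\<eta> q \<le> w s - h / 2" using peak(2,3) pqs by linarith+
  qed (simp add: peak(1))
  then show ?thesis using pqs by linarith
qed

text \<open>Reflection preserves tube and energy; it reduces valleys of \<open>w\<close>, where the
  string touches the upper wall, to peaks.\<close>

lemma unique_minimizer_uminus:
  assumes min: "unique_minimizer (\<lambda>x. \<bar>x\<bar>\<^sup>2) a b (admissible w h a b A B) \<eta>"
    and w: "continuous_on {a..b} w" "a \<le> b"
  shows "unique_minimizer (\<lambda>x. \<bar>x\<bar>\<^sup>2) a b (admissible (\<lambda>t. - w t) h a b (- A) (- B)) (\<lambda>t. - \<eta> t)"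
proof -
  let ?S = "admissible w h a b A B" and ?S' = "admissible (\<lambda>t. - w t) h a b (- A) (- B)"
  have w': "continuous_on {a..b} (\<lambda>t. - w t)" using w by (intro continuous_intros)
  have ac: "abs_cont_on a b (\<lambda>t. - f t)" if "abs_cont_on a b f" for f
    by (rule abs_cont_on_contract[OF that]) auto
  have mem: "(\<lambda>t. - f t) \<in> ?S'" if "f \<in> ?S" for f
    using that ac unfolding mem_admissible_iff[OF w] mem_admissible_iff[OF w' w(2)]
    by (auto simp: abs_minus_commute)
  have mem': "(\<lambda>t. - f t) \<in> ?S" if "f \<in> ?S'" for f
    using that ac unfolding mem_admissible_iff[OF w] mem_admissible_iff[OF w' w(2)]
    by (auto simp: abs_minus_commute add.commute)
  have cost: "cost (\<lambda>x. \<bar>x\<bar>\<^sup>2) a b (\<lambda>t. - f t) = cost (\<lambda>x. \<bar>x\<bar>\<^sup>2) a b f" for f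
    unfolding cost_square energy_def deriv_uminus_square ..
  show ?thesis
    unfolding unique_minimizer_def
  proof (intro conjI ballI impI)
    show "(\<lambda>t. - \<eta> t) \<in> ?S'" using min mem by (auto simp: unique_minimizer_def)
    show "cost (\<lambda>x. \<bar>x\<bar>\<^sup>2) a b (\<lambda>t. - \<eta> t) \<le> cost (\<lambda>x. \<bar>x\<bar>\<^sup>2) a b f" if "f \<in> ?S'" for f
    proof -
      have "cost (\<lambda>x. \<bar>x\<bar>\<^sup>2) a b \<eta> \<le> cost (\<lambda>x. \<bar>x\<bar>\<^sup>2) a b (\<lambda>t. - f t)"
        using min mem'[OF that] unfolding unique_minimizer_def by blast
      then show ?thesis by (simp only: cost)
    qed
    fix f t assume f: "f \<in> ?S'" "\<forall>g\<in>?S'. cost (\<lambda>x. \<bar>x\<bar>\<^sup>2) a b f \<le> cost (\<lambda>x. \<bar>x\<bar>\<^sup>2) a b g"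
      and t: "t \<in> {a..b}"
    have "cost (\<lambda>x. \<bar>x\<bar>\<^sup>2) a b (\<lambda>t. - f t) \<le> cost (\<lambda>x. \<bar>x\<bar>\<^sup>2) a b g" if "g \<in> ?S" for g
      using f(2) mem[OF that] cost by (metis (no_types, lifting))
    then have "- f t = \<eta> t"
      using min mem'[OF f(1)] t unfolding unique_minimizer_def by blast
    then show "f t = - \<eta> t" by simp
  qed
qed

subsection \<open>The times of rise and drop\<close>

lemma running_inf_attained:
  fixes v :: "real \<Rightarrow> real"
  assumes "continuous_on {s..t} v" "s \<le> t"
  obtains u where "u \<in> {s..t}" "(INF x\<in>{s..t}. v x) = v u" "\<And>x. x \<in> {s..t} \<Longrightarrow> v u \<le> v x"
proof -
  obtain u where u: "u \<in> {s..t}" "\<And>x. x \<in> {s..t} \<Longrightarrow> v u \<le> v x"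
    using continuous_attains_inf[of "{s..t}" v] assms by auto
  then have "(INF x\<in>{s..t}. v x) = v u" by (intro cInf_eq_minimum) auto
  then show ?thesis using that[of u] u by auto
qed

lemma running_inf_eq_iff:
  fixes v :: "real \<Rightarrow> real"
  assumes "continuous_on {s..t} v" "s \<le> t"
  shows "(INF x\<in>{s..t}. v x) = v t \<longleftrightarrow> (\<forall>x\<in>{s..t}. v t \<le> v x)"
proof -
  obtain u where u: "u \<in> {s..t}" "(INF x\<in>{s..t}. v x) = v u" "\<And>x. x \<in> {s..t} \<Longrightarrow> v u \<le> v x"
    using running_inf_attained[OF assms] by blast
  have "t \<in> {s..t}" using assms(2) by simp
  then show ?thesis using u by (metis antisym)
qed

text \<open>Drops and last maxima are rises and last minima of the reflected path, so only the
  latter are studied below.\<close>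

lemma first_drop_eq_first_rise_uminus:
  "first_drop w h s = first_rise (\<lambda>t. - w t) h s"
proof -
  have "(INF u\<in>{s..t}. - w u) = - (SUP u\<in>{s..t}. w u)" for t
    by (simp add: Inf_real_def image_image)
  then show ?thesis by (simp add: first_drop_def first_rise_def algebra_simps)
qed

lemma last_max_eq_last_min_uminus: "last_max w s e = last_min (\<lambda>t. - w t) s e"
proof -
  have "(INF u\<in>{s..t}. - w u) = - (SUP u\<in>{s..t}. w u)" for t
    by (simp add: Inf_real_def image_image)
  then show ?thesis by (simp add: last_max_def last_min_def)
qed

lemma le_first_rise: "ereal s \<le> first_rise v h s"
  by (auto simp: first_rise_def intro!: INF_greatest)

lemma le_last_min: "ereal s \<le> e \<Longrightarrow> ereal s \<le> last_min v s e"
  by (auto simp: last_min_def intro!: SUP_upper)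

lemma last_min_le: "last_min v s e \<le> e"
  by (auto simp: last_min_def intro!: SUP_least)

text \<open>If \<open>v\<close> gained more than \<open>h\<close> between \<open>u\<close> and \<open>x\<close>, then it would gain exactly \<open>h\<close> over the
  minimum of \<open>[s,x]\<close> at some time before \<open>x\<close>.\<close>

lemma rise_le_before_first_rise:
  fixes v :: "real \<Rightarrow> real"
  assumes v: "continuous_on {s..} v" and "h > 0" "s \<le> u" "u \<le> x" "ereal x \<le> first_rise v h s"
  shows "v x - v u \<le> h"
proof (rule ccontr)
  assume "\<not> v x - v u \<le> h"
  then have gt: "v x > v u + h" by simp
  have cont: "continuous_on {c..d} v" if "s \<le> c" for c d
    using v by (rule continuous_on_subset) (use that in auto)
  have "s \<le> x" using assms by simp
  then obtain m where m: "m \<in> {s..x}" "(INF y\<in>{s..x}. v y) = v m" "\<And>y. y \<in> {s..x} \<Longrightarrow> v m \<le> v y"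
    using running_inf_attained[OF cont[OF order_refl] \<open>s \<le> x\<close>] by blast
  have "v m \<le> v u" using m(3)[of u] assms by simp
  then have mx: "v m + h < v x" using gt by simp
  obtain t where t: "m \<le> t" "t \<le> x" "v t = v m + h"
    using IVT'[of v m "v m + h" x] mx m(1) cont[of m x] \<open>h > 0\<close> by auto
  have "t \<noteq> x" using t mx by auto
  have "(INF y\<in>{s..t}. v y) = v m"
    using m t by (intro cInf_eq_minimum) auto
  then have "t \<in> {t. s \<le> t \<and> v t - (INF y\<in>{s..t}. v y) = h}" using t m by auto
  then have "first_rise v h s \<le> ereal t" unfolding first_rise_def by (intro INF_lower)
  then have "ereal x \<le> ereal t" using assms(5) by (rule order_trans[rotated])
  then show False using t \<open>t \<noteq> x\<close> by simp
qed

text \<open>The infimum in \<open>first_rise\<close> is not known to be attained; continuity carries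
  the exact rise from nearby times \<open>t\<close> over to \<open>b\<close>.\<close>

lemma rise_at_first_rise:
  fixes v :: "real \<Rightarrow> real"
  assumes v: "continuous_on {s..} v" and h: "h > 0" and b: "first_rise v h s = ereal b"
    and m: "m \<in> {s..b}" "\<And>x. x \<in> {s..b} \<Longrightarrow> v m \<le> v x"
  shows "v b = v m + h"
proof (rule antisym)
  show "v b \<le> v m + h"
    using rise_le_before_first_rise[OF v h, of m b] b m(1) by simp
  show "v m + h \<le> v b"
  proof (rule ccontr)
    assume "\<not> v m + h \<le> v b"
    \<comment> \<open>Half of the deficit: close to \<open>b\<close> the path stays below
      \<open>v m + h\<close>, and two values there differ by less than \<open>2 * ?e\<close>, which
      is at most \<open>h\<close> because \<open>v m \<le> v b\<close>.\<close>
    then have e: "0 < (v m + h - v b) / 2" (is "0 < ?e") by simp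
    have sb: "s \<le> b" using m(1) by simp
    have e2: "2 * ?e \<le> h" using m(2)[of b] sb by simp
    obtain d where d: "d > 0" "\<And>x. x \<in> {s..} \<Longrightarrow> dist x b < d \<Longrightarrow> dist (v x) (v b) < ?e"
      using v e sb unfolding continuous_on_iff by (meson atLeast_iff)
    have "first_rise v h s < ereal (b + d)" using b d(1) by simp
    then obtain t where t: "s \<le> t" "v t - (INF x\<in>{s..t}. v x) = h" "t < b + d"
      unfolding first_rise_def Inf_less_iff by auto
    have "first_rise v h s \<le> ereal t"
      unfolding first_rise_def using t by (intro INF_lower) auto
    then have tb: "b \<le> t" using b by simp
    have "continuous_on {s..t} v" using v by (rule continuous_on_subset) auto
    then obtain u where u: "u \<in> {s..t}" "(INF x\<in>{s..t}. v x) = v u"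
      using running_inf_attained t(1) by metis
    have near: "\<bar>v x - v b\<bar> < ?e" if "b \<le> x" "x \<le> t" for x
      using d(2)[of x] that t sb by (auto simp: dist_real_def)
    have "v t - v u < h"
    proof (cases "u \<le> b")
      case True
      then have "v m \<le> v u" using m(2) u by simp
      then show ?thesis using near[of t] tb e by (simp add: field_simps abs_if split: if_splits)
    next
      case False
      then have "\<bar>v u - v b\<bar> < ?e" "\<bar>v t - v b\<bar> < ?e" using near u tb by auto
      then show ?thesis using e2 by linarith
    qed
    then show False using t u by simp
  qed
qed

text \<open>\<open>q\<close> is a limit of times at which \<open>v\<close> equals its running
  minimum, and continuity preserves this. The end \<open>e\<close> may be infinite, as it is when no
  further rise occurs.\<close>

lemma last_min_is_min:
  fixes v :: "real \<Rightarrow> real"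
  assumes v: "continuous_on {s..} v" and q: "last_min v s e = ereal q" and e: "ereal s \<le> e"
    and x: "x \<in> {s..q}"
  shows "v q \<le> v x"
proof (rule ccontr)
  assume gt: "\<not> v q \<le> v x"
  then have "x < q" using x by (cases "x = q") auto
  have "0 < v q - v x" using gt by simp
  moreover have "q \<in> {s..}" using x by simp
  ultimately obtain d where d: "d > 0" "\<And>y. y \<in> {s..} \<Longrightarrow> dist y q < d \<Longrightarrow> dist (v y) (v q) < v q - v x"
    using v unfolding continuous_on_iff by meson
  \<comment> \<open>The time \<open>t\<close> must lie beyond \<open>x\<close>, so that
    \<open>x\<close> counts in its running minimum, and within \<open>d\<close> of
    \<open>q\<close>.\<close>
  have "ereal (max x (q - d)) < last_min v s e" using q \<open>x < q\<close> d(1) by simp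
  then obtain t where t: "s \<le> t" "ereal t \<le> e" "(INF y\<in>{s..t}. v y) = v t" "max x (q - d) < t"
    unfolding last_min_def less_Sup_iff by auto
  have "ereal t \<le> last_min v s e"
    unfolding last_min_def using t by (intro SUP_upper) auto
  then have "t \<le> q" using q by simp
  have "continuous_on {s..t} v" using v by (rule continuous_on_subset) auto
  then have "v t \<le> v x" using running_inf_eq_iff[of s t v] t x by auto
  moreover have "\<bar>v t - v q\<bar> < v q - v x"
    using d(2)[of t] t \<open>t \<le> q\<close> by (auto simp: dist_real_def)
  ultimately show False by linarith
qed

text \<open>A minimizer over \<open>{s..b}\<close> is a candidate for \<open>p\<close>, so
  \<open>p\<close> is no earlier and its value no larger. Hence the minimum over the whole phase is
  at \<open>p\<close>, and the gain at \<open>b\<close> is counted from \<open>v p\<close>.\<close>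

lemma last_min_first_rise:
  fixes v :: "real \<Rightarrow> real"
  assumes v: "continuous_on {s..} v" and h: "h > 0"
    and b: "first_rise v h s = ereal b" and p: "last_min v s (ereal b) = ereal p"
  shows "s \<le> p" "p \<le> b" "\<And>x. x \<in> {s..b} \<Longrightarrow> v p \<le> v x" "v b = v p + h"
    "\<And>x. x \<in> {p..b} \<Longrightarrow> v x \<le> v b"
proof -
  have sb: "ereal s \<le> ereal b" using le_first_rise[of s v h] b by simp
  show sp: "s \<le> p" using le_last_min[OF sb, of v] p by simp
  show pb: "p \<le> b" using last_min_le[of v s "ereal b"] p by simp
  have cont: "continuous_on {s..t} v" for t using v by (rule continuous_on_subset) auto
  obtain m where m: "m \<in> {s..b}" "\<And>x. x \<in> {s..b} \<Longrightarrow> v m \<le> v x"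
    using running_inf_attained[OF cont sb[unfolded ereal_less_eq]] by blast
  have "(INF y\<in>{s..m}. v y) = v m"
    using running_inf_eq_iff[OF cont[of m]] m by auto
  then have "ereal m \<le> last_min v s (ereal b)"
    unfolding last_min_def using m(1) by (intro SUP_upper) auto
  then have "m \<le> p" using p by simp
  then have "v p \<le> v m" using last_min_is_min[OF v p sb, of m] m(1) by simp
  then show min: "v p \<le> v x" if "x \<in> {s..b}" for x using m(2)[OF that] by simp
  show vb: "v b = v p + h" by (rule rise_at_first_rise[OF v h b]) (use sp pb min in auto)
  show "v x \<le> v b" if "x \<in> {p..b}" for x
    using rise_le_before_first_rise[OF v h, of p x] b vb sp that by simp
qed

text \<open>Up to \<open>b\<close> the path is at most \<open>v b\<close>; on \<open>{b..c}\<close>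
  the maximum is at \<open>s\<close>; after \<open>c\<close> it regains at most \<open>h\<close>
  from \<open>v c = v s - h\<close>. The rise time after \<open>c\<close> may be infinite: only
  \<open>q\<close> has to be finite.\<close>

lemma peak_between_last_mins:
  fixes v :: "real \<Rightarrow> real"
  assumes v: "continuous_on {a..} v" and h: "h > 0"
    and b: "first_rise v h a = ereal b" and p: "last_min v a (ereal b) = ereal p"
    and c: "first_drop v h b = ereal c" and s: "last_max v b (ereal c) = ereal s"
    and q: "last_min v c (first_rise v h c) = ereal q"
  shows "s \<in> {p..q}" "\<And>t. t \<in> {p..q} \<Longrightarrow> v t \<le> v s" "v p + h \<le> v s" "v q + h \<le> v s"
proof -
  note rise = last_min_first_rise[OF v h b p]
  have vb: "continuous_on {b..} v" using v by (rule continuous_on_subset) (use rise in auto)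
  then have "continuous_on {b..} (\<lambda>t. - v t)" by (rule continuous_on_minus)
  note drop = last_min_first_rise[OF this h c[unfolded first_drop_eq_first_rise_uminus]
      s[unfolded last_max_eq_last_min_uminus]]
  have vc: "continuous_on {c..} v" using vb by (rule continuous_on_subset) (use drop in auto)
  have cq: "c \<le> q" using le_last_min[OF le_first_rise, of c v v h] q by simp
  have vbs: "v b \<le> v s" and vcs: "v c = v s - h" using drop(3)[of b] drop(1,2,4) by auto
  show "s \<in> {p..q}" using rise drop cq by simp
  show "v p + h \<le> v s" using rise(4) vbs by simp
  have "v q \<le> v c" using last_min_is_min[OF vc q le_first_rise, of c] cq by simp
  then show "v q + h \<le> v s" using vcs by simp
  have qr: "ereal q \<le> first_rise v h c" using last_min_le[of v c "first_rise v h c"] q by simp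
  show "v t \<le> v s" if t: "t \<in> {p..q}" for t
  proof -
    consider "t \<in> {p..b}" | "t \<in> {b..c}" | "t \<in> {c..q}"
      using t drop(1,2) by (cases "t \<le> b"; cases "t \<le> c") auto
    then show ?thesis
    proof cases
      case 1
      then show ?thesis using rise(5) vbs by force
    next
      case 2
      then show ?thesis using drop(3) by force
    next
      case 3
      then have "ereal t \<le> first_rise v h c" using qr by (auto intro: order_trans[rotated])
      then have "v t - v c \<le> h" using rise_le_before_first_rise[OF vc h, of c t] 3 by simp
      then show ?thesis using vcs by simp
    qed
  qed
qed

section \<open>The sequences \<open>tm\<close> and \<open>tbar\<close>\<close>

lemma tm_nonneg: "tm w h n \<ge> 0"
proof (induction n)
  case (Suc n)
  show ?case
  proof (cases "tm w h n")
    case (real r)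
    then have "0 \<le> ereal r" using Suc by simp
    from order_trans[OF this le_first_rise] show ?thesis
      using real
      by (auto simp: first_drop_eq_first_rise_uminus)
  qed (use Suc in auto)
qed simp

lemma tm_cases:
  obtains (infinite) "tm w h n = \<infinity>" | (finite) r where "tm w h n = ereal r" "0 \<le> r"
  using tm_nonneg[of w h n] by (cases "tm w h n") auto

text \<open>With \<open>tbar_le_tm\<close> this interlaces the two sequences, so \<open>tbar\<close>
  is monotone and a finite \<open>tbar\<close> makes the preceding \<open>tm\<close> finite.\<close>

lemma tm_le_tbar_Suc: "tm w h n \<le> tbar w h (Suc n)"
  using le_first_rise le_last_min
  by (cases rule: tm_cases[of w h n])
    (auto simp: first_drop_eq_first_rise_uminus last_max_eq_last_min_uminus)

lemma tbar_le_tm: "tbar w h n \<le> tm w h n"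
  by (cases n) (auto simp: last_max_eq_last_min_uminus last_min_le)

lemma tbar_mono: "m \<le> n \<Longrightarrow> tbar w h m \<le> tbar w h n"
  by (rule lift_Suc_mono_le[of "tbar w h", OF order_trans[OF tbar_le_tm tm_le_tbar_Suc]])

declare tm.simps(2) [simp del] tbar.simps(2) [simp del]

text \<open>The count is a supremum, possibly infinite, so some index above \<open>n\<close> is
  taken from the set and monotonicity leads back to \<open>Suc n\<close>.\<close>

lemma tbar_le_if_count:
  assumes "enat (Suc n) \<le> tbar_count w h T"
  shows "tbar w h (Suc n) \<le> ereal T"
proof -
  have "enat n < tbar_count w h T" using assms by (simp add: Suc_ile_eq)
  then obtain m where "tbar w h m \<le> ereal T" "n < m"
    unfolding tbar_count_def less_Sup_iff by auto
  then show ?thesis using order_trans[OF tbar_mono[of "Suc n" m w h]] by simp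
qed

lemma tbar_finite:
  assumes "tbar w h n \<le> ereal T"
  obtains r where "tbar w h n = ereal r" "0 \<le> r" "r \<le> T"
proof -
  have "0 \<le> tbar w h n" using tbar_mono[of 0 n w h] by simp
  then show ?thesis using assms that by (cases "tbar w h n") auto
qed

text \<open>\<open>i \<ge> 2\<close> is needed: the string starts in the middle of the tube at time 0, so for \<open>i = 1\<close> it
  may start on the wrong side of the truncation level.\<close>

lemma unique_minimizer_at_tbar:
  assumes min: "unique_minimizer (\<lambda>x. \<bar>x\<bar>\<^sup>2) 0 T (admissible w h 0 T A B) \<eta>"
    and h: "h > 0" and w: "continuous_on {0..} w"
    and i: "2 \<le> i" "tbar w h (Suc i) \<le> ereal T" and r: "tbar w h i = ereal r"
  shows "\<eta> r = w r - (-1) ^ i * (h / 2)"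
proof -
  \<comment> \<open>The times \<open>p\<close>, \<open>r\<close>, \<open>q\<close> will be
    \<open>tbar\<close> at \<open>i - 1\<close>, \<open>i\<close>, \<open>i + 1\<close>, and the
    path is followed from \<open>tm\<close> at \<open>k = i - 2\<close>.\<close>
  obtain k where "i = 2 + k" using le_Suc_ex[OF i(1)] ..
  then have k: "i = Suc (Suc k)" by simp
  obtain q where q: "tbar w h (Suc i) = ereal q" "0 \<le> q" "q \<le> T"
    by (rule tbar_finite[OF i(2)])
  have "tbar w h (Suc k) \<le> ereal T"
    by (rule order_trans[OF tbar_mono i(2)]) (simp add: k)
  then obtain p where p: "tbar w h (Suc k) = ereal p" "0 \<le> p" "p \<le> T" by (rule tbar_finite)
  \<comment> \<open>Interlacing reaches only \<open>j \<le> i\<close>; \<open>tm\<close> at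
    \<open>Suc i\<close> may be infinite.\<close>
  have tmT: "tm w h j \<le> ereal T" if "j \<le> i" for j
    by (rule order_trans[OF tm_le_tbar_Suc order_trans[OF tbar_mono i(2)]]) (simp add: that)
  have fin: "\<exists>x. tm w h j = ereal x \<and> 0 \<le> x" if "j \<le> i" for j
    using tmT[OF that] by (cases rule: tm_cases[of w h j]) auto
  obtain a where a: "tm w h k = ereal a" "0 \<le> a" using fin[of k] k by auto
  obtain b where b: "tm w h (Suc k) = ereal b" using fin[of "Suc k"] k by auto
  obtain c where c: "tm w h (Suc (Suc k)) = ereal c" using fin[of i] k by auto
  note eqs = p(1) q(1)[unfolded k] r[unfolded k] b c
  have T: "0 \<le> T" using q by simp
  have wT: "continuous_on {0..T} w" using w by (rule continuous_on_subset) auto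
  show ?thesis
  proof (cases "even k")
    case True
    have wa: "continuous_on {a..} w" using w by (rule continuous_on_subset) (use a in auto)
    have ks: "first_rise w h a = ereal b" "last_min w a (ereal b) = ereal p"
      "first_drop w h b = ereal c" "last_max w b (ereal c) = ereal r"
      "last_min w c (first_rise w h c) = ereal q"
      using eqs a True by (auto simp: tm.simps(2) tbar.simps(2))
    note peak = peak_between_last_mins[OF wa h ks]
    have "\<eta> r = w r - h / 2"
      by (rule unique_minimizer_at_peak[OF min wT p(2) q(3) peak])
    then show ?thesis using True k by simp
  next
    case False
    \<comment> \<open>For odd \<open>k\<close> rises and drops swap roles, so the previous case is
      applied to the reflected path and string.\<close>
    let ?v = "\<lambda>t. - w t"
    have wa: "continuous_on {a..} ?v"
      using w by (intro continuous_on_minus continuous_on_subset[OF w]) (use a in auto)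
    have ks: "first_rise ?v h a = ereal b" "last_min ?v a (ereal b) = ereal p"
      "first_drop ?v h b = ereal c" "last_max ?v b (ereal c) = ereal r"
      "last_min ?v c (first_rise ?v h c) = ereal q"
      using eqs a False
      by (auto simp: tm.simps(2) tbar.simps(2) first_drop_eq_first_rise_uminus last_max_eq_last_min_uminus)
    note peak = peak_between_last_mins[OF wa h ks]
    have "- \<eta> r = ?v r - h / 2"
      by (rule unique_minimizer_at_peak[OF unique_minimizer_uminus[OF min wT T]
          continuous_on_minus[OF wT] p(2) q(3) peak])
    then show ?thesis using False k by simp
  qed
qed

theorem theorem1p1:
  fixes w :: "real \<Rightarrow> real" and h T :: real and \<eta> :: "real \<Rightarrow> real"
  assumes "h > 0"
    and "continuous_on {0..} w"
    and "T > 0"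
    and "taut_string w h T \<eta>"
    and "tbar_count w h T \<ge> 4"
  shows "\<forall>i::nat. 2 \<le> i \<and> enat i + 2 \<le> tbar_count w h T \<longrightarrow>
           (\<forall>\<psi>. is_psi w h i \<psi> \<longrightarrow>
             (\<forall>t\<in>{real_of_ereal (tbar w h i)..real_of_ereal (tbar w h (i + 1))}. \<eta> t = \<psi> t))"
proof (intro allI impI ballI)
  fix i \<psi> t
  assume i: "2 \<le> i \<and> enat i + 2 \<le> tbar_count w h T" and \<psi>: "is_psi w h i \<psi>"
    and t: "t \<in> {real_of_ereal (tbar w h i)..real_of_ereal (tbar w h (i + 1))}"
  have min: "unique_minimizer (\<lambda>x. \<bar>x\<bar>\<^sup>2) 0 T (admissible w h 0 T (w 0) (w T)) \<eta>"
    using assms(4) strictly_convex_square unfolding taut_string_def by blast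
  have wT: "continuous_on {0..T} w" using assms(2) by (rule continuous_on_subset) auto
  have "enat (Suc (Suc i)) \<le> tbar_count w h T" using i by (simp add: numeral_eq_enat)
  then have last: "tbar w h (Suc (Suc i)) \<le> ereal T" by (rule tbar_le_if_count)
  have mid: "tbar w h (Suc i) \<le> ereal T" by (rule order_trans[OF tbar_mono last]) simp
  have "tbar w h i \<le> ereal T" by (rule order_trans[OF tbar_mono last]) simp
  then obtain a where a: "tbar w h i = ereal a" "0 \<le> a" by (rule tbar_finite)
  obtain b where b: "tbar w h (Suc i) = ereal b" "b \<le> T" by (rule tbar_finite[OF mid])
  have ab: "a \<le> b" using tbar_mono[of i "Suc i" w h] a b by simp
  \<comment> \<open>Touching at \<open>a\<close> needs \<open>tbar\<close> at \<open>i + 1\<close>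
    to be at most \<open>T\<close>, touching at \<open>b\<close> needs this at \<open>i + 2\<close>.
    The sign flips with the parity, which gives exactly the end values of \<psi>.\<close>
  have \<eta>a: "\<eta> a = w a - (-1) ^ i * (h / 2)"
    using unique_minimizer_at_tbar[OF min assms(1,2) _ mid a(1)] i by simp
  have \<eta>b: "\<eta> b = w b + (-1) ^ i * (h / 2)"
    using unique_minimizer_at_tbar[OF min assms(1,2) _ last b(1)] i by simp
  let ?S = "admissible w h a b (\<eta> a) (\<eta> b)"
  have \<psi>min: "unique_minimizer (\<lambda>x. \<bar>x\<bar>\<^sup>2) a b ?S \<psi>"
    using \<psi> unfolding is_psi_def Let_def \<eta>a \<eta>b by (simp add: a b)
  have wab: "continuous_on {a..b} w" using wT by (rule continuous_on_subset) (use a b in auto)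
  have \<psi>S: "\<psi> \<in> ?S" using \<psi>min unfolding unique_minimizer_def by blast
  have "\<eta> \<in> admissible w h 0 T (w 0) (w T)" using min unfolding unique_minimizer_def by blast
  \<comment> \<open>Restricted to \<open>{a..b}\<close>, \<eta> competes with \<psi>, so \<psi> has
    no more energy there and may be pasted into \<eta>.\<close>
  then have "\<eta> \<in> ?S"
    unfolding mem_admissible_iff[OF wab ab] mem_admissible_iff[OF wT less_imp_le[OF assms(3)]]
    using a b by (auto intro: abs_cont_on_subset)
  then have "cost (\<lambda>x. \<bar>x\<bar>\<^sup>2) a b \<psi> \<le> cost (\<lambda>x. \<bar>x\<bar>\<^sup>2) a b \<eta>"
    using \<psi>min unfolding unique_minimizer_def by blast
  then have le: "energy a b \<psi> \<le> energy a b \<eta>"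
    unfolding cost_square by (simp add: less_eq_ennreal.rep_eq)
  have "t \<in> {a..b}" using t by (simp add: a b)
  moreover have "abs_cont_on a b \<psi>" "\<psi> a = \<eta> a" "\<psi> b = \<eta> b"
    "\<And>t. t \<in> {a..b} \<Longrightarrow> \<bar>w t - \<psi> t\<bar> \<le> h / 2"
    using \<psi>S unfolding mem_admissible_iff[OF wab ab] by blast+
  ultimately have "\<psi> t = \<eta> t"
    using unique_minimizer_replace[OF min wT a(2) ab b(2) _ _ _ _ le] by blast
  then show "\<eta> t = \<psi> t" by simp
qed

end
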